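(* Let $\varnothing\ne T\subset\mathbb{R}$ and let $(M,\|\cdot\|)$ be a reflexive Banach space over $\mathbb{K}=\mathbb{R}$ or $\mathbb{C}$ with separable dual $(M^*,\|\cdot\|)$. Suppose the sequence $\{f_j\}_{j=1}^\infty\subset M^T$ is such that (i) $\sup_{j\in\mathbb{N}}\|f_j(t)\|<\infty$ for all $t\in T$; (ii) $v_{x^*}(\varepsilon)\equiv\limsup_{j\to\infty}V_\varepsilon(\langle f_j(\cdot),x^*\rangle,T)<\infty$ for all $\varepsilon>0$ and $x^*\in M^*$. Then there are a subsequence of $\{f_j\}$, again denoted by $\{f_j\}$, and a function $f\in M^T$, satisfying $V_\varepsilon(\langle f(\cdot),x^*\rangle,T)\le v_{x^*}(\varepsilon)$ for all $\varepsilon>0$ and $x^*\in M^*$, such that $f_j(t)$ converges weakly to $f(t)$ in $M$ as $j\to\infty$ for all $t\in T$.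
   Context: $M^T$ is the set of all functions $f:T\to M$. For $x\in M$, $x^*\in M^*$ one writes $\langle x,x^*\rangle=x^*(x)\in\mathbb{K}$, and $\langle f(\cdot),x^*\rangle:T\to\mathbb{K}$ denotes the function $t\mapsto\langle f(t),x^*\rangle$. For a function $h:T\to\mathbb{K}$, the (Jordan) variation is $V(h,T)=\sup\sum_{i=1}^m|h(t_i)-h(t_{i-1})|\in[0,\infty]$, the supremum being over all $m\in\mathbb{N}$ and all $t_0\le t_1\le\dots\le t_m$ in $T$. For $\varepsilon>0$, the $\varepsilon$-variation of $h:T\to\mathbb{K}$ is $$V_\varepsilon(h,T)=\inf\Bigl\{V(g,T): g:T\to\mathbb{K},\ V(g,T)<\infty,\ \sup_{t\in T}|h(t)-g(t)|\le\varepsilon\Bigr\}\in[0,\infty],\qquad \inf\varnothing=\infty.$$ *)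

theory Defs
  imports "HOL-Analysis.Analysis"
begin

text \<open>
  A normed space over a scalar field \<open>'k\<close>. The norm and the underlying additive structure are those of
  the type \<open>'m\<close>; the axiom \<open>scale_of_real\<close> says that the real scalar multiplication built into the
  type class of \<open>'m\<close> is the restriction of \<open>smul\<close> to real scalars. The locale is applied below to
  \<open>'k\<close> of sort \<open>{real_normed_field, euclidean_space}\<close>, a sort to which both \<open>real\<close> and \<open>complex\<close>
  belong and whose members are, up to isometric isomorphism, only these two fields (a
  finite-dimensional field extension of the reals is the reals or the complex numbers, and the norm
  of a \<open>real_normed_field\<close> is multiplicative).
\<close>

locale normed_space = vector_space smul
  for smul :: "'k::real_normed_field \<Rightarrow> 'm::real_normed_vector \<Rightarrow> 'm" +
  assumes norm_scale: "norm (smul a x) = norm a * norm x"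
    and scale_of_real: "smul (of_real r) x = r *\<^sub>R x"

lemma normed_space_scaleR: "normed_space (scaleR :: real \<Rightarrow> 'm::real_normed_vector \<Rightarrow> 'm)"
  by (intro normed_space.intro real_vector.vector_space_axioms normed_space_axioms.intro) simp_all

lemma normed_space_times: "normed_space ((*) :: 'k::real_normed_field \<Rightarrow> 'k \<Rightarrow> 'k)"
  by (intro normed_space.intro vector_space_over_itself.vector_space_axioms
      normed_space_axioms.intro) (simp_all add: norm_mult scaleR_conv_of_real)

text \<open>
  The dual space: the \<open>'k\<close>-linear functionals among the bounded real-linear maps. Norm and topology are
  inherited from \<open>'m \<Rightarrow>\<^sub>L 'k\<close>, that is, the norm is the operator norm.
\<close>

definition dual ::
    "('k::real_normed_field \<Rightarrow> 'm::real_normed_vector \<Rightarrow> 'm) \<Rightarrow> ('m \<Rightarrow>\<^sub>L 'k) set" where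
  "dual smul = {\<phi>. \<forall>a x. blinfun_apply \<phi> (smul a x) = a * blinfun_apply \<phi> x}"

lemma dual_scaleR: "dual scaleR = (UNIV :: ('m::real_normed_vector \<Rightarrow>\<^sub>L real) set)"
  by (auto simp: dual_def blinfun.scaleR_right)

text \<open>
  The bidual: bounded \<open>'k\<close>-linear functionals on the dual. Since the dual is a set rather than a type,
  these are functions of which only the values on \<^term>\<open>dual smul\<close> matter. The composition in the
  third clause is the functional \<open>\<lambda>x. a * \<phi> x\<close>.
\<close>

definition bidual ::
    "('k::real_normed_field \<Rightarrow> 'm::real_normed_vector \<Rightarrow> 'm) \<Rightarrow> (('m \<Rightarrow>\<^sub>L 'k) \<Rightarrow> 'k) set" where
  "bidual smul = {\<Phi>.
     (\<forall>\<phi>\<in>dual smul. \<forall>\<psi>\<in>dual smul. \<Phi> (\<phi> + \<psi>) = \<Phi> \<phi> + \<Phi> \<psi>) \<and>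
     (\<forall>a. \<forall>\<phi>\<in>dual smul. \<Phi> (blinfun_mult_right a o\<^sub>L \<phi>) = a * \<Phi> \<phi>) \<and>
     (\<exists>C. \<forall>\<phi>\<in>dual smul. norm (\<Phi> \<phi>) \<le> C * norm \<phi>)}"

text \<open>Reflexivity: the canonical embedding into the bidual is onto.\<close>

definition reflexive_space ::
    "('k::real_normed_field \<Rightarrow> 'm::real_normed_vector \<Rightarrow> 'm) \<Rightarrow> bool" where
  "reflexive_space smul \<longleftrightarrow>
     (\<forall>\<Phi>\<in>bidual smul. \<exists>x. \<forall>\<phi>\<in>dual smul. \<Phi> \<phi> = blinfun_apply \<phi> x)"

definition weakly_converges ::
    "('k::real_normed_field \<Rightarrow> 'm::real_normed_vector \<Rightarrow> 'm) \<Rightarrow> (nat \<Rightarrow> 'm) \<Rightarrow> 'm \<Rightarrow> bool" where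
  "weakly_converges smul u x \<longleftrightarrow>
     (\<forall>\<phi>\<in>dual smul. (\<lambda>j. blinfun_apply \<phi> (u j)) \<longlonglongrightarrow> blinfun_apply \<phi> x)"

text \<open>
  Functions on \<open>T\<close> are represented by total functions on the reals; the notions below depend only on
  their values on \<open>T\<close>. The infimum of the empty set in \<^typ>\<open>ennreal\<close> is infinity.
\<close>

definition variation :: "(real \<Rightarrow> 'k::real_normed_vector) \<Rightarrow> real set \<Rightarrow> ennreal" where
  "variation h T = (SUP (m, t) \<in> {(m :: nat, t :: nat \<Rightarrow> real).
     1 \<le> m \<and> t ` {0..m} \<subseteq> T \<and> mono_on {0..m} t}.
       ennreal (\<Sum>i=1..m. norm (h (t i) - h (t (i - 1)))))"

definition eps_variation :: "real \<Rightarrow> (real \<Rightarrow> 'k::real_normed_vector) \<Rightarrow> real set \<Rightarrow> ennreal" where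
  "eps_variation \<epsilon> h T = Inf {variation g T | g.
     variation g T < \<infinity> \<and> (SUP t\<in>T. ennreal (norm (h t - g t))) \<le> ennreal \<epsilon>}"

end

theory Submission
  imports Defs "HOL-Complex_Analysis.Great_Picard"
begin

text \<open>
  Fix a countable dense set \<open>D\<close> in the dual. Finiteness of \<open>v\<close> says that, for \<open>\<phi> \<in> D\<close> and a tolerance
  \<open>\<epsilon> = 1 / (k + 1)\<close>, almost all scalar functions \<open>\<langle>f\<^sub>j, \<phi>\<rangle>\<close> lie uniformly within \<open>\<epsilon>\<close> of functions whose
  variation is bounded independently of \<open>j\<close>. Helly's selection principle, applied simultaneously to
  the countable family of approximating sequences indexed by \<open>(\<phi>, k)\<close>, yields one subsequence along
  which all approximants converge pointwise on \<open>T\<close>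
  (\<open>helly_bounded_variation_family\<close>). A scalar sequence that is approximated
  arbitrarily well by convergent ones converges (\<open>convergent_if_approximable\<close>), so
  \<open>\<langle>f\<^sub>j(t), \<phi>\<rangle>\<close> converges for \<open>\<phi> \<in> D\<close>, and, since \<open>f\<^sub>j(t)\<close> is bounded in norm, the same principle
  carries this from \<open>D\<close> to the whole dual. The limit is a bounded functional of \<open>\<phi>\<close>; reflexivity
  represents it by a point, the value of the limit function at \<open>t\<close>
  (\<open>reflexive_weak_limit\<close>).

  The estimate on the limit is lower semicontinuity of the \<open>\<epsilon>\<close>-variation under pointwise
  convergence (\<open>eps_variation_limit_le\<close>): if \<open>V\<^sub>\<epsilon>\<close> of almost all members is below \<open>c\<close>, a second use of
  Helly's principle extracts from their \<open>\<epsilon>\<close>-approximants a pointwise limit, which has variation at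
  most \<open>c\<close> and is an \<open>\<epsilon>\<close>-approximant of the limit function.

  Helly's principle is proved first for monotone functions: a subsequence that converges on the
  rationals converges at every continuity point of the monotone limit, and a further subsequence
  takes care of the countably many jumps. A function
  \<open>g\<close> of bounded variation is reduced to this case through its variation function
  \<open>w(t) = V(g, T \<inter> (-\<infinity>, t])\<close>: both \<open>w\<close> and \<open>w + g \<bullet> b\<close>, for \<open>b\<close> in an orthonormal basis of
  the scalars, are nondecreasing.
\<close>

section \<open>Helly's principle for countable families of monotone functions\<close>

lemma pointwise_bounded_convergent_subsequence:
  fixes h :: "nat \<Rightarrow> 'a \<Rightarrow> real"
  assumes S: "countable S" and B: "\<And>j x. x \<in> S \<Longrightarrow> \<bar>h j x\<bar> \<le> B x"
  obtains r where "strict_mono (r :: nat \<Rightarrow> nat)" "\<And>x. x \<in> S \<Longrightarrow> convergent (\<lambda>j. h (r j) x)"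
proof -
  have "norm (h j x / (1 + \<bar>B x\<bar>)) \<le> 1" if "x \<in> S" for j x
    using B[OF that, of j] by (auto simp: divide_simps abs_if)
  then obtain r where r: "strict_mono (r :: nat \<Rightarrow> nat)"
    "\<And>x. x \<in> S \<Longrightarrow> \<exists>l. (\<lambda>j. h (r j) x / (1 + \<bar>B x\<bar>)) \<longlonglongrightarrow> l"
    using function_convergent_subsequence[OF S, of "\<lambda>j x. h j x / (1 + \<bar>B x\<bar>)" 1] by blast
  have "convergent (\<lambda>j. h (r j) x)" if x: "x \<in> S" for x
  proof -
    obtain l where l: "(\<lambda>j. h (r j) x / (1 + \<bar>B x\<bar>)) \<longlonglongrightarrow> l"
      using r(2)[OF x] by blast
    have "1 + \<bar>B x\<bar> \<noteq> 0" by linarith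
    then have "(\<lambda>j. h (r j) x) \<longlonglongrightarrow> (1 + \<bar>B x\<bar>) * l"
      using tendsto_mult_left[OF l, of "1 + \<bar>B x\<bar>"] by simp
    then show ?thesis by (rule convergentI)
  qed
  with r(1) show thesis by (rule that)
qed

text \<open>
  Monotonicity squeezes \<open>W j x\<close> between \<open>W j a\<close> and \<open>W j b\<close> for rational \<open>a < x < b\<close>, so convergence
  on the rationals forces convergence wherever the limit has no jump.
\<close>

lemma monotone_limit_at_continuity_point:
  fixes W :: "nat \<Rightarrow> real \<Rightarrow> real" and F :: "real \<Rightarrow> real"
  assumes W: "\<And>j. mono (W j)"
    and lim: "\<And>q. q \<in> \<rat> \<Longrightarrow> (\<lambda>j. W j q) \<longlonglongrightarrow> F q"
    and F: "isCont F x"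
  shows "(\<lambda>j. W j x) \<longlonglongrightarrow> F x"
proof (rule LIMSEQ_I)
  fix e :: real assume e: "0 < e"
  then obtain d where d: "0 < d" "\<And>y. \<bar>y - x\<bar> < d \<Longrightarrow> \<bar>F y - F x\<bar> < e / 2"
    using F[unfolded continuous_at_eps_delta, rule_format, of "e/2"]
    by (auto simp: dist_real_def)
  obtain a where a: "a \<in> \<rat>" "x - d < a" "a < x"
    using Rats_dense_in_real[of "x - d" x] d(1) by auto
  obtain b where b: "b \<in> \<rat>" "x < b" "b < x + d"
    using Rats_dense_in_real[of x "x + d"] d(1) by auto
  have ab: "\<bar>F a - F x\<bar> < e / 2" "\<bar>F b - F x\<bar> < e / 2"
    using d(2)[of a] d(2)[of b] a b by auto
  have "\<forall>\<^sub>F j in sequentially. dist (W j a) (F a) < e / 2"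
    "\<forall>\<^sub>F j in sequentially. dist (W j b) (F b) < e / 2"
    using tendstoD[OF lim[OF a(1)] half_gt_zero[OF e]] tendstoD[OF lim[OF b(1)] half_gt_zero[OF e]]
    by blast+
  then have "\<forall>\<^sub>F j in sequentially. norm (W j x - F x) < e"
  proof eventually_elim
    case (elim j)
    moreover have "W j a \<le> W j x" "W j x \<le> W j b"
      using monoD[OF W] a b by auto
    ultimately show ?case using ab unfolding dist_real_def real_norm_def by linarith
  qed
  then show "\<exists>no. \<forall>n\<ge>no. norm (W n x - F x) < e"
    by (simp add: eventually_sequentially)
qed

lemma monotone_extension_from_rationals:
  fixes L :: "real \<Rightarrow> real"
  assumes L: "mono_on \<rat> L"
  obtains F where "mono F" "\<And>q. q \<in> \<rat> \<Longrightarrow> F q = L q"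
proof -
  define F where "F x = (SUP q\<in>{q\<in>\<rat>. q \<le> x}. L q)" for x
  have ne: "{q \<in> \<rat>. q \<le> x} \<noteq> {}" for x :: real
    using Rats_dense_in_real[of "x - 1" x] by auto
  have bdd: "bdd_above (L ` {q \<in> \<rat>. q \<le> x})" for x
  proof -
    obtain b where "b \<in> \<rat>" "x < b" using Rats_dense_in_real[of x "x + 1"] by auto
    then show ?thesis
      by (intro bdd_aboveI[of _ "L b"]) (auto intro: mono_onD[OF L])
  qed
  have "mono F"
    unfolding F_def by (intro monoI cSUP_subset_mono ne bdd) auto
  moreover have "F q = L q" if "q \<in> \<rat>" for q
    unfolding F_def using that
    by (intro cSup_eq_maximum) (auto intro: mono_onD[OF L])
  ultimately show thesis by (rule that)
qed

lemma helly_monotone_family: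
  fixes W :: "nat \<Rightarrow> 'p \<Rightarrow> real \<Rightarrow> real"
  assumes P: "countable P"
    and mono: "\<And>j p. p \<in> P \<Longrightarrow> mono (W j p)"
    and B: "\<And>j p x. p \<in> P \<Longrightarrow> \<bar>W j p x\<bar> \<le> B p"
  obtains r where "strict_mono (r :: nat \<Rightarrow> nat)"
    "\<And>p x. p \<in> P \<Longrightarrow> convergent (\<lambda>j. W (r j) p x)"
proof -
  have "countable (P \<times> (\<rat> :: real set))"
    using P countable_rat by blast
  then obtain r1 where r1: "strict_mono (r1 :: nat \<Rightarrow> nat)"
    and conv1: "\<And>z. z \<in> P \<times> \<rat> \<Longrightarrow> convergent (\<lambda>j. W (r1 j) (fst z) (snd z))"
    using B by (elim pointwise_bounded_convergent_subsequence
        [where h = "\<lambda>j z. W j (fst z) (snd z)" and B = "\<lambda>z. B (fst z)"]) auto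
  define L where "L p q = lim (\<lambda>j. W (r1 j) p q)" for p q
  have L: "(\<lambda>j. W (r1 j) p q) \<longlonglongrightarrow> L p q" if "p \<in> P" "q \<in> \<rat>" for p q
    using conv1[of "(p, q)"] that unfolding L_def convergent_LIMSEQ_iff by simp
  have "mono_on \<rat> (L p)" if p: "p \<in> P" for p
    by (intro mono_onI LIMSEQ_le[OF L[OF p] L[OF p]]) (auto intro: monoD[OF mono[OF p]])
  then have "\<exists>F. mono F \<and> (\<forall>q\<in>\<rat>. F q = L p q)" if "p \<in> P" for p
    using that monotone_extension_from_rationals by metis
  then obtain F where F: "\<And>p. p \<in> P \<Longrightarrow> mono (F p)"
    "\<And>p q. p \<in> P \<Longrightarrow> q \<in> \<rat> \<Longrightarrow> F p q = L p q"
    by metis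
  have cont: "convergent (\<lambda>j. W (r1 j) p x)" if p: "p \<in> P" and x: "isCont (F p) x" for p x
    using monotone_limit_at_continuity_point[of "\<lambda>j. W (r1 j) p" "F p" x] mono[OF p] x
      F(2)[OF p] L[OF p] by (auto intro: convergentI)
  \<comment> \<open>Only the jumps of the limits remain, and these are countably many.\<close>
  define J where "J = (SIGMA p:P. {x. \<not> isCont (F p) x})"
  have "countable J"
    unfolding J_def by (intro countable_SIGMA P mono_ctble_discont F(1))
  then obtain r2 where r2: "strict_mono (r2 :: nat \<Rightarrow> nat)"
    and conv2: "\<And>z. z \<in> J \<Longrightarrow> convergent (\<lambda>j. W (r1 (r2 j)) (fst z) (snd z))"
    using B by (elim pointwise_bounded_convergent_subsequence
        [where h = "\<lambda>j z. W (r1 j) (fst z) (snd z)" and B = "\<lambda>z. B (fst z)"])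
      (auto simp: J_def)
  show thesis
  proof (rule that)
    show "strict_mono (r1 \<circ> r2)" using r1 r2 by (rule strict_mono_o)
    fix p x assume p: "p \<in> P"
    show "convergent (\<lambda>j. W ((r1 \<circ> r2) j) p x)"
    proof (cases "isCont (F p) x")
      case True
      from convergent_subseq_convergent[OF cont[OF p True] r2] show ?thesis
        by (simp add: o_def)
    next
      case False
      with p conv2[of "(p, x)"] show ?thesis by (simp add: J_def)
    qed
  qed
qed

text \<open>
  A nondecreasing function on \<open>T\<close> extends to the line by the supremum of its earlier values, so the
  domain \<open>T\<close> may be arbitrary.
\<close>

lemma bounded_monotone_extension:
  fixes u :: "real \<Rightarrow> real"
  assumes u: "mono_on T u" and B: "\<And>t. t \<in> T \<Longrightarrow> \<bar>u t\<bar> \<le> B" and "0 \<le> B"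
  obtains U where "mono U" "\<And>t. t \<in> T \<Longrightarrow> U t = u t" "\<And>x. \<bar>U x\<bar> \<le> B"
proof -
  \<comment> \<open>Inserting \<open>- B\<close> keeps the set nonempty to the left of \<open>T\<close>.\<close>
  define A where "A x = insert (- B) (u ` (T \<inter> {..x}))" for x
  have A: "\<bar>y\<bar> \<le> B" if "y \<in> A x" for x y
    using that B \<open>0 \<le> B\<close> by (auto simp: A_def)
  have bdd: "bdd_above (A x)" for x
    using A by (intro bdd_aboveI[of _ B]) (auto simp: abs_le_iff)
  have "mono (\<lambda>x. Sup (A x))"
    by (intro monoI cSup_subset_mono bdd) (auto simp: A_def)
  moreover have "Sup (A t) = u t" if t: "t \<in> T" for t
  proof (rule cSup_eq_maximum)
    show "u t \<in> A t" using t by (simp add: A_def)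
    show "y \<le> u t" if "y \<in> A t" for y
      using that B[OF t] mono_onD[OF u _ t] by (auto simp: A_def)
  qed
  moreover have "\<bar>Sup (A x)\<bar> \<le> B" for x
  proof -
    have "- B \<le> Sup (A x)" by (rule cSup_upper[OF _ bdd]) (simp add: A_def)
    moreover have "Sup (A x) \<le> B"
      using A by (intro cSup_least) (auto simp: A_def abs_le_iff)
    ultimately show ?thesis by simp
  qed
  ultimately show thesis by (rule that)
qed

lemma helly_monotone_on_family:
  fixes u :: "nat \<Rightarrow> 'p \<Rightarrow> real \<Rightarrow> real"
  assumes P: "countable P"
    and mono: "\<And>j p. p \<in> P \<Longrightarrow> mono_on T (u j p)"
    and B: "\<And>j p t. p \<in> P \<Longrightarrow> t \<in> T \<Longrightarrow> \<bar>u j p t\<bar> \<le> B p"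
  obtains r where "strict_mono (r :: nat \<Rightarrow> nat)"
    "\<And>p t. p \<in> P \<Longrightarrow> t \<in> T \<Longrightarrow> convergent (\<lambda>j. u (r j) p t)"
proof -
  define ext where "ext j p U \<longleftrightarrow>
      mono U \<and> (\<forall>t\<in>T. U t = u j p t) \<and> (\<forall>x. \<bar>U x\<bar> \<le> \<bar>B p\<bar>)" for j p U
  have "\<exists>U. ext j p U" if p: "p \<in> P" for j p
  proof -
    have "\<bar>u j p t\<bar> \<le> \<bar>B p\<bar>" if "t \<in> T" for t using B[OF p that, of j] by linarith
    from bounded_monotone_extension[OF mono[OF p] this abs_ge_zero] show ?thesis
      unfolding ext_def by metis
  qed
  then have "\<forall>j p. \<exists>U. p \<in> P \<longrightarrow> ext j p U" by blast
  then obtain U where "\<And>j p. p \<in> P \<Longrightarrow> ext j p (U j p)"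
    unfolding choice_iff by blast
  then have U: "\<And>j p. p \<in> P \<Longrightarrow> mono (U j p)"
    "\<And>j p t. p \<in> P \<Longrightarrow> t \<in> T \<Longrightarrow> U j p t = u j p t"
    "\<And>j p x. p \<in> P \<Longrightarrow> \<bar>U j p x\<bar> \<le> \<bar>B p\<bar>"
    unfolding ext_def by blast+
  obtain r where r: "strict_mono (r :: nat \<Rightarrow> nat)"
    and conv: "\<And>p x. p \<in> P \<Longrightarrow> convergent (\<lambda>j. U (r j) p x)"
    using helly_monotone_family[of P U "\<lambda>p. \<bar>B p\<bar>"] P U(1,3) by blast
  have "convergent (\<lambda>j. u (r j) p t)" if "p \<in> P" "t \<in> T" for p t
    using conv[OF that(1), of t] U(2)[OF that] by simp
  with r show thesis by (rule that)
qed

section \<open>Variation\<close>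

lemma variation_upper:
  fixes m :: nat
  assumes "1 \<le> m" "t ` {0..m} \<subseteq> T" "mono_on {0..m} t"
  shows "ennreal (\<Sum>i=1..m. norm (h (t i) - h (t (i - 1)))) \<le> variation h T"
  unfolding variation_def
  using assms by (intro SUP_upper2[where i = "(m, t)"]) auto

lemma variation_least:
  assumes "\<And>(m :: nat) t. 1 \<le> m \<Longrightarrow> t ` {0..m} \<subseteq> T \<Longrightarrow> mono_on {0..m} t \<Longrightarrow>
    ennreal (\<Sum>i=1..m. norm (h (t i) - h (t (i - 1)))) \<le> c"
  shows "variation h T \<le> c"
  unfolding variation_def by (rule SUP_least) (use assms in auto)

lemma variation_mono:
  assumes "S \<subseteq> T" shows "variation h S \<le> variation h T"
  using assms by (intro variation_least variation_upper) auto

lemma variation_const: "variation (\<lambda>_. a) T = 0"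
  by (rule antisym[OF variation_least]) auto

lemma norm_diff_le_variation:
  assumes "s \<in> T" "t \<in> T"
  shows "ennreal (norm (h t - h s)) \<le> variation h T"
proof -
  have *: "ennreal (norm (h t - h s)) \<le> variation h T"
    if "s \<le> t" "s \<in> T" "t \<in> T" for s t
  proof -
    have "mono_on {0..1 :: nat} (\<lambda>i. if i = 0 then s else t)"
      using that by (auto simp: mono_on_def)
    from variation_upper[OF _ _ this, of T h] that show ?thesis
      by (simp add: image_subset_iff)
  qed
  show ?thesis
    using *[of s t] *[of t s] assms by (cases "s \<le> t") (auto simp: norm_minus_commute)
qed

text \<open>
  A partition of \<open>T \<inter> {..s}\<close> continues to a partition of \<open>T \<inter> {..t}\<close> by appending \<open>s\<close> and then \<open>t\<close>.
\<close>

lemma variation_atMost_increment: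
  assumes st: "s \<in> T" "t \<in> T" "s \<le> t"
  shows "variation h (T \<inter> {..s}) + ennreal (norm (h t - h s)) \<le> variation h (T \<inter> {..t})"
proof -
  have *: "ennreal (\<Sum>i=1..m. norm (h (p i) - h (p (i - 1)))) + ennreal (norm (h t - h s))
      \<le> variation h (T \<inter> {..t})" (is "ennreal ?S + _ \<le> _")
    if m: "1 \<le> m" and p: "p ` {0..m} \<subseteq> T \<inter> {..s}" and mono: "mono_on {0..m} p" for m :: nat and p
  proof -
    define q where "q i = (if i \<le> m then p i else if i = m + 1 then s else t)" for i
    have eq: "(\<Sum>i=1..m. norm (h (q i) - h (q (i - 1)))) = ?S"
      by (intro sum.cong) (auto simp: q_def)
    have ps: "p i \<in> T" "p i \<le> s" if "i \<le> m" for i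
      using p that by (auto simp: image_subset_iff)
    have "?S + norm (h t - h s) \<le> ?S + norm (h s - h (p m)) + norm (h t - h s)"
      by simp
    also have "\<dots> = (\<Sum>i=1..Suc (Suc m). norm (h (q i) - h (q (i - 1))))"
      using eq by (simp add: q_def)
    finally have le: "?S + norm (h t - h s) \<le> \<dots>" .
    have "mono_on {0..Suc (Suc m)} q"
      using ps st mono by (auto simp: mono_on_def q_def intro: order_trans)
    moreover have "q ` {0..Suc (Suc m)} \<subseteq> T \<inter> {..t}"
      using ps st by (auto simp: q_def intro: order_trans)
    ultimately have "ennreal (\<Sum>i=1..Suc (Suc m). norm (h (q i) - h (q (i - 1))))
        \<le> variation h (T \<inter> {..t})"
      by (intro variation_upper) auto
    then have "ennreal (?S + norm (h t - h s)) \<le> variation h (T \<inter> {..t})"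
      using le by (meson ennreal_leI order_trans)
    then show ?thesis by (simp add: sum_nonneg)
  qed
  have ne: "{(m :: nat, p :: nat \<Rightarrow> real).
      1 \<le> m \<and> p ` {0..m} \<subseteq> T \<inter> {..s} \<and> mono_on {0..m} p} \<noteq> {}"
    using st(1) by (auto intro!: exI[of _ "1 :: nat"] exI[of _ "\<lambda>_. s"] simp: mono_on_def)
  show ?thesis
    unfolding variation_def[of h "T \<inter> {..s}"]
    by (subst ennreal_SUP_add_left[OF ne, symmetric]) (auto intro!: SUP_least * simp del: One_nat_def)
qed

lemma variation_limit_le:
  fixes g :: "real \<Rightarrow> 'k::real_normed_vector"
  assumes lim: "\<And>t. t \<in> T \<Longrightarrow> (\<lambda>j. G j t) \<longlonglongrightarrow> g t"
    and G: "\<And>j. variation (G j) T \<le> c"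
  shows "variation g T \<le> c"
proof (rule variation_least)
  fix m :: nat and t :: "nat \<Rightarrow> real"
  assume t: "1 \<le> m" "t ` {0..m} \<subseteq> T" "mono_on {0..m} t"
  have "(\<lambda>j. ennreal (\<Sum>i=1..m. norm (G j (t i) - G j (t (i - 1)))))
      \<longlonglongrightarrow> ennreal (\<Sum>i=1..m. norm (g (t i) - g (t (i - 1))))"
    using t(2) by (intro tendsto_ennrealI tendsto_sum tendsto_norm tendsto_diff lim) auto
  moreover have "ennreal (\<Sum>i=1..m. norm (G j (t i) - G j (t (i - 1)))) \<le> c" for j
    using variation_upper[OF t, of "G j"] G[of j] by (rule order_trans)
  ultimately show "ennreal (\<Sum>i=1..m. norm (g (t i) - g (t (i - 1)))) \<le> c"
    by (intro LIMSEQ_le_const2) auto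
qed

section \<open>Helly's principle for functions of bounded variation\<close>

text \<open>
  The increments of the variation function dominate those of \<open>h\<close>, hence adding a component of \<open>h\<close>
  to it does not destroy monotonicity.
\<close>

lemma variation_function_plus_component:
  fixes h :: "real \<Rightarrow> 'k::real_inner"
  assumes fin: "variation h T < \<infinity>" and b: "norm b \<le> 1"
  shows "mono_on T (\<lambda>t. enn2real (variation h (T \<inter> {..t})) + h t \<bullet> b)"
proof (rule mono_onI)
  fix s t assume st: "s \<in> T" "t \<in> T" "s \<le> t"
  have fin': "variation h (T \<inter> {..x}) < \<infinity>" for x
    using variation_mono[of "T \<inter> {..x}" T h] fin by (auto intro: le_less_trans)
  have "ennreal (enn2real (variation h (T \<inter> {..s})) + norm (h t - h s))
      \<le> ennreal (enn2real (variation h (T \<inter> {..t})))"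
    using variation_atMost_increment[OF st, of h] fin' by simp
  then have "enn2real (variation h (T \<inter> {..s})) + norm (h t - h s)
      \<le> enn2real (variation h (T \<inter> {..t}))"
    by (subst (asm) ennreal_le_iff) auto
  moreover have "\<bar>(h t - h s) \<bullet> b\<bar> \<le> norm (h t - h s)"
    using Cauchy_Schwarz_ineq2[of "h t - h s" b] b
    by (meson mult_left_le norm_ge_zero order_trans)
  ultimately show "enn2real (variation h (T \<inter> {..s})) + h s \<bullet> b
      \<le> enn2real (variation h (T \<inter> {..t})) + h t \<bullet> b"
    by (simp add: inner_diff_left)
qed

lemma helly_bounded_variation_family:
  fixes g :: "nat \<Rightarrow> 'p \<Rightarrow> real \<Rightarrow> 'k::euclidean_space"
  assumes P: "countable P"
    and V: "\<And>j p. p \<in> P \<Longrightarrow> variation (g j p) T \<le> ennreal (C p)"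
    and bdd: "\<And>p t. p \<in> P \<Longrightarrow> t \<in> T \<Longrightarrow> \<exists>B. \<forall>j. norm (g j p t) \<le> B"
  obtains r where "strict_mono (r :: nat \<Rightarrow> nat)"
    "\<And>p t. p \<in> P \<Longrightarrow> t \<in> T \<Longrightarrow> convergent (\<lambda>j. g (r j) p t)"
proof (cases "T = {}")
  case True
  then show thesis using that[of id] by (simp add: strict_mono_def)
next
  case False
  then obtain t0 where t0: "t0 \<in> T" by blast
  obtain B where B: "\<And>j p. p \<in> P \<Longrightarrow> norm (g j p t0) \<le> B p"
    using bdd[OF _ t0] by metis
  define w where "w j p t = enn2real (variation (g j p) (T \<inter> {..t}))" for j p t
  have V_lt: "variation (g j p) T < \<infinity>" if "p \<in> P" for j p
    using V[OF that, of j] by (auto simp: top_unique less_top[symmetric])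
  have g_le: "norm (g j p t) \<le> B p + \<bar>C p\<bar>" if p: "p \<in> P" and t: "t \<in> T" for j p t
  proof -
    have "ennreal (norm (g j p t - g j p t0)) \<le> ennreal \<bar>C p\<bar>"
      using norm_diff_le_variation[OF t0 t, of "g j p"] V[OF p, of j]
      by (meson abs_ge_self ennreal_leI order_trans)
    then have "norm (g j p t - g j p t0) \<le> \<bar>C p\<bar>" by simp
    then show ?thesis
      using B[OF p, of j] norm_triangle_sub[of "g j p t" "g j p t0"] by linarith
  qed
  have w_le: "\<bar>w j p t\<bar> \<le> \<bar>C p\<bar>" if p: "p \<in> P" for j p t
  proof -
    have "variation (g j p) (T \<inter> {..t}) \<le> ennreal \<bar>C p\<bar>"
      using variation_mono[of "T \<inter> {..t}" T "g j p"] V[OF p, of j]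
      by (meson abs_ge_self ennreal_leI inf_le1 order_trans)
    then have "w j p t \<le> \<bar>C p\<bar>"
      unfolding w_def by (intro enn2real_leI) auto
    then show ?thesis by (simp add: w_def)
  qed
  \<comment> \<open>The index \<open>b = 0\<close> accounts for the variation function itself.\<close>
  define Q where "Q = P \<times> insert 0 (Basis :: 'k set)"
  define u where "u j z t = w j (fst z) t + g j (fst z) t \<bullet> snd z" for j z t
  have b1: "norm b \<le> 1" if "b \<in> insert 0 (Basis :: 'k set)" for b
    using that by (auto simp: norm_Basis)
  have Q: "countable Q"
    unfolding Q_def by (intro countable_SIGMA P countable_finite) auto
  have u_mono: "mono_on T (u j z)" if "z \<in> Q" for j z
  proof -
    obtain p b where z: "z = (p, b)" "p \<in> P" "b \<in> insert 0 Basis"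
      using \<open>z \<in> Q\<close> unfolding Q_def by blast
    show ?thesis
      unfolding u_def w_def z(1) fst_conv snd_conv
      by (rule variation_function_plus_component[OF V_lt[OF z(2)] b1[OF z(3)]])
  qed
  have u_le: "\<bar>u j z t\<bar> \<le> \<bar>C (fst z)\<bar> + (B (fst z) + \<bar>C (fst z)\<bar>)"
    if z: "z \<in> Q" and t: "t \<in> T" for j z t
  proof -
    have p: "fst z \<in> P" and b: "norm (snd z) \<le> 1"
      using z b1 by (auto simp: Q_def)
    have "\<bar>g j (fst z) t \<bullet> snd z\<bar> \<le> norm (g j (fst z) t)"
      using Cauchy_Schwarz_ineq2[of "g j (fst z) t" "snd z"] b
      by (meson mult_left_le norm_ge_zero order_trans)
    with g_le[OF p t, of j] w_le[OF p, of j t] show ?thesis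
      unfolding u_def by linarith
  qed
  obtain r where r: "strict_mono (r :: nat \<Rightarrow> nat)"
    and conv: "\<And>z t. z \<in> Q \<Longrightarrow> t \<in> T \<Longrightarrow> convergent (\<lambda>j. u (r j) z t)"
    using helly_monotone_on_family[of Q T u
        "\<lambda>z. \<bar>C (fst z)\<bar> + (B (fst z) + \<bar>C (fst z)\<bar>)"] Q u_mono u_le by blast
  have "convergent (\<lambda>j. g (r j) p t)" if p: "p \<in> P" and t: "t \<in> T" for p t
  proof -
    have "convergent (\<lambda>j. g (r j) p t \<bullet> b)" if b: "b \<in> Basis" for b
      using convergent_diff[OF conv[of "(p, b)" t] conv[of "(p, 0)" t]] p t b
      by (simp add: Q_def u_def)
    then obtain l where "\<And>b. b \<in> Basis \<Longrightarrow> (\<lambda>j. g (r j) p t \<bullet> b) \<longlonglongrightarrow> l b"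
      unfolding convergent_def by metis
    then have "(\<lambda>j. \<Sum>b\<in>Basis. (g (r j) p t \<bullet> b) *\<^sub>R b) \<longlonglongrightarrow> (\<Sum>b\<in>Basis. l b *\<^sub>R b)"
      by (intro tendsto_sum tendsto_scaleR tendsto_const)
    then show ?thesis by (auto simp: euclidean_representation intro: convergentI)
  qed
  with r show thesis by (rule that)
qed

section \<open>Limits of approximable sequences\<close>

text \<open>
  This principle serves twice: for the \<open>\<epsilon>\<close>-approximants of a scalar function, and for the passage
  from a dense set of functionals to its closure.
\<close>

lemma convergent_if_approximable:
  fixes a :: "nat \<Rightarrow> 'a::banach"
  assumes "\<And>e. 0 < e \<Longrightarrow>
    \<exists>b. convergent b \<and> (\<forall>\<^sub>F j in sequentially. norm (a j - b j) \<le> e)"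
  shows "convergent a"
proof (rule Cauchy_convergent, rule CauchyI)
  fix e :: real assume e: "0 < e"
  then obtain b where b: "convergent b" "\<forall>\<^sub>F j in sequentially. norm (a j - b j) \<le> e / 4"
    using assms[of "e / 4"] by auto
  obtain M where M: "\<And>m n. m \<ge> M \<Longrightarrow> n \<ge> M \<Longrightarrow> norm (b m - b n) < e / 2"
    using CauchyD[OF convergent_Cauchy[OF b(1)], of "e / 2"] e by auto
  obtain N where N: "\<And>n. n \<ge> N \<Longrightarrow> norm (a n - b n) \<le> e / 4"
    using b(2) by (auto simp: eventually_sequentially)
  have "norm (a m - a n) < e" if "m \<ge> max M N" "n \<ge> max M N" for m n
  proof -
    have "norm (a m - a n) \<le> norm (a m - b m) + norm (b m - b n) + norm (a n - b n)"
      using norm_triangle_ineq4[of "(a m - b m) + (b m - b n)" "a n - b n"]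
        norm_triangle_ineq[of "a m - b m" "b m - b n"] by simp
    with M[of m n] N[of m] N[of n] that show ?thesis by simp
  qed
  then show "\<exists>M. \<forall>m\<ge>M. \<forall>n\<ge>M. norm (a m - a n) < e" by blast
qed

lemma convergent_blinfun_on_closure:
  fixes u :: "nat \<Rightarrow> 'm::real_normed_vector" and \<phi> :: "'m \<Rightarrow>\<^sub>L 'k::banach"
  assumes B: "\<And>j. norm (u j) \<le> B"
    and D: "\<And>\<psi>. \<psi> \<in> D \<Longrightarrow> convergent (\<lambda>j. blinfun_apply \<psi> (u j))"
    and \<phi>: "\<phi> \<in> closure D"
  shows "convergent (\<lambda>j. blinfun_apply \<phi> (u j))"
proof (rule convergent_if_approximable)
  fix e :: real assume e: "0 < e"
  have B0: "0 \<le> B" using B[of 0] norm_ge_zero order_trans by blast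
  obtain \<psi> where \<psi>: "\<psi> \<in> D" "dist \<psi> \<phi> < e / (B + 1)"
    using \<phi> e B0 closure_approachable[of \<phi> D] by (metis add_nonneg_pos divide_pos_pos zero_less_one)
  have "norm (blinfun_apply \<phi> (u j) - blinfun_apply \<psi> (u j)) \<le> e" for j
  proof -
    have "norm (blinfun_apply \<phi> (u j) - blinfun_apply \<psi> (u j)) = norm (blinfun_apply (\<phi> - \<psi>) (u j))"
      by (simp add: blinfun.diff_left)
    also have "\<dots> \<le> norm (\<phi> - \<psi>) * norm (u j)" by (rule norm_blinfun)
    also have "\<dots> \<le> e / (B + 1) * (B + 1)"
      using \<psi>(2) B[of j] B0 e by (intro mult_mono) (auto simp: dist_norm norm_minus_commute)
    finally show ?thesis using B0 by simp
  qed
  with D[OF \<psi>(1)] show "\<exists>b. convergent b \<and>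
      (\<forall>\<^sub>F j in sequentially. norm (blinfun_apply \<phi> (u j) - b j) \<le> e)"
    by (intro exI[of _ "\<lambda>j. blinfun_apply \<psi> (u j)"]) simp
qed

text \<open>The limits form a bounded functional on the dual; reflexivity supplies the point.\<close>

lemma reflexive_weak_limit:
  fixes smul :: "'k::real_normed_field \<Rightarrow> 'm::real_normed_vector \<Rightarrow> 'm"
  assumes refl: "reflexive_space smul"
    and B: "\<And>j. norm (u j) \<le> B"
    and conv: "\<And>\<phi>. \<phi> \<in> dual smul \<Longrightarrow> convergent (\<lambda>j. blinfun_apply \<phi> (u j))"
  shows "\<exists>x. weakly_converges smul u x"
proof -
  define \<Phi> where "\<Phi> \<phi> = lim (\<lambda>j. blinfun_apply \<phi> (u j))" for \<phi> :: "'m \<Rightarrow>\<^sub>L 'k"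
  have \<Phi>: "(\<lambda>j. blinfun_apply \<phi> (u j)) \<longlonglongrightarrow> \<Phi> \<phi>" if "\<phi> \<in> dual smul" for \<phi>
    using conv[OF that] unfolding \<Phi>_def convergent_LIMSEQ_iff .
  have "\<Phi> (\<phi> + \<psi>) = \<Phi> \<phi> + \<Phi> \<psi>" if "\<phi> \<in> dual smul" "\<psi> \<in> dual smul" for \<phi> \<psi>
    using tendsto_add[OF \<Phi>[OF that(1)] \<Phi>[OF that(2)]]
    unfolding \<Phi>_def[of "\<phi> + \<psi>"] by (intro limI) (simp add: blinfun.add_left)
  moreover have "\<Phi> (blinfun_mult_right a o\<^sub>L \<phi>) = a * \<Phi> \<phi>" if "\<phi> \<in> dual smul" for a \<phi>
    using tendsto_mult_left[OF \<Phi>[OF that], of a]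
    unfolding \<Phi>_def[of "blinfun_mult_right a o\<^sub>L \<phi>"] by (intro limI) simp
  moreover have "norm (\<Phi> \<phi>) \<le> B * norm \<phi>" if "\<phi> \<in> dual smul" for \<phi>
  proof (rule LIMSEQ_le_const2[OF tendsto_norm[OF \<Phi>[OF that]]])
    have "norm (blinfun_apply \<phi> (u j)) \<le> B * norm \<phi>" for j
      using norm_blinfun[of \<phi> "u j"] mult_right_mono[OF B[of j], of "norm \<phi>"]
      by (simp add: mult.commute)
    then show "\<exists>N. \<forall>n\<ge>N. norm (blinfun_apply \<phi> (u n)) \<le> B * norm \<phi>" by blast
  qed
  ultimately have "\<Phi> \<in> bidual smul" unfolding bidual_def by blast
  then obtain x where "\<And>\<phi>. \<phi> \<in> dual smul \<Longrightarrow> \<Phi> \<phi> = blinfun_apply \<phi> x"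
    using refl unfolding reflexive_space_def by blast
  with \<Phi> show ?thesis unfolding weakly_converges_def by metis
qed

lemma separable_dual_dense:
  assumes "separable_space (top_of_set S)"
  obtains D where "countable D" "D \<subseteq> S" "S \<subseteq> closure D"
proof -
  obtain D where D: "countable D" "D \<subseteq> S" "top_of_set S closure_of D = S"
    using assms unfolding separable_space_def by auto
  then have "S \<subseteq> closure D"
    by (metis closure_of_subtopology_subset euclidean_closure_of)
  with D show thesis by (auto intro: that)
qed

section \<open>The \<open>\<epsilon>\<close>-variation\<close>

lemma eps_variation_lessE:
  assumes "eps_variation \<epsilon> h T < c" "0 \<le> \<epsilon>"
  obtains g where "variation g T < c" "\<And>t. t \<in> T \<Longrightarrow> norm (h t - g t) \<le> \<epsilon>"
proof -
  obtain g where g: "variation g T < c" "(SUP t\<in>T. ennreal (norm (h t - g t))) \<le> ennreal \<epsilon>"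
    using assms(1) unfolding eps_variation_def Inf_less_iff by auto
  have "norm (h t - g t) \<le> \<epsilon>" if "t \<in> T" for t
  proof -
    have "ennreal (norm (h t - g t)) \<le> ennreal \<epsilon>"
      using g(2) that by (meson SUP_upper order_trans)
    then show ?thesis using assms(2) by simp
  qed
  with g(1) show thesis by (rule that)
qed

lemma eps_variation_le:
  assumes "variation g T \<le> c" "c < \<infinity>" "\<And>t. t \<in> T \<Longrightarrow> norm (h t - g t) \<le> \<epsilon>"
  shows "eps_variation \<epsilon> h T \<le> c"
proof -
  have "eps_variation \<epsilon> h T \<le> variation g T"
    unfolding eps_variation_def
    by (rule Inf_lower) (use assms in \<open>auto intro!: SUP_least ennreal_leI intro: le_less_trans\<close>)
  also note assms(1)
  finally show ?thesis .
qed

lemma eps_variation_limit_le: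
  fixes h :: "nat \<Rightarrow> real \<Rightarrow> 'k::euclidean_space"
  assumes lim: "\<And>t. t \<in> T \<Longrightarrow> (\<lambda>j. h j t) \<longlonglongrightarrow> h' t" and \<epsilon>: "0 \<le> \<epsilon>"
  shows "eps_variation \<epsilon> h' T \<le> limsup (\<lambda>j. eps_variation \<epsilon> (h j) T)"
proof (rule dense_ge)
  fix c assume c: "limsup (\<lambda>j. eps_variation \<epsilon> (h j) T) < c"
  show "eps_variation \<epsilon> h' T \<le> c"
  proof (cases "c = \<infinity>")
    case False
    then obtain C where C: "c = ennreal C" by (cases c) auto
    from Limsup_lessD[OF c] obtain N where
      N: "\<And>j. j \<ge> N \<Longrightarrow> eps_variation \<epsilon> (h j) T < c"
      by (auto simp: eventually_sequentially)
    have "\<exists>g. variation g T < c \<and> (\<forall>t\<in>T. norm (h (j + N) t - g t) \<le> \<epsilon>)" for j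
      using eps_variation_lessE[OF N \<epsilon>, of "j + N"] by (metis le_add2)
    then obtain G where G: "\<And>j. variation (G j) T < c"
      "\<And>j t. t \<in> T \<Longrightarrow> norm (h (j + N) t - G j t) \<le> \<epsilon>"
      by metis
    have bdd: "\<exists>B. \<forall>j. norm (G j t) \<le> B" if t: "t \<in> T" for t
    proof -
      have "Bseq (\<lambda>j. h j t)" using lim[OF t] by (intro convergent_imp_Bseq convergentI)
      then obtain K where K: "\<And>j. norm (h j t) \<le> K" by (auto simp: Bseq_def)
      have "norm (G j t) \<le> K + \<epsilon>" for j
        using G(2)[OF t, of j] K[of "j + N"] norm_triangle_sub[of "G j t" "h (j + N) t"]
        by (simp add: norm_minus_commute)
      then show ?thesis by blast
    qed
    obtain r where r: "strict_mono (r :: nat \<Rightarrow> nat)"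
      and conv: "\<And>t. t \<in> T \<Longrightarrow> convergent (\<lambda>j. G (r j) t)"
      using helly_bounded_variation_family[of "{()}" "\<lambda>j _. G j" T "\<lambda>_. C"] G(1) bdd
      by (auto simp: C less_imp_le)
    define g where "g t = lim (\<lambda>j. G (r j) t)" for t
    have g: "(\<lambda>j. G (r j) t) \<longlonglongrightarrow> g t" if "t \<in> T" for t
      using conv[OF that] unfolding g_def convergent_LIMSEQ_iff .
    show ?thesis
    proof (rule eps_variation_le)
      show "variation g T \<le> c"
        using G(1) by (intro variation_limit_le[OF g]) (auto intro: less_imp_le)
      show "c < \<infinity>" by (simp add: C)
      fix t assume t: "t \<in> T"
      have "(\<lambda>j. h (r j + N) t) \<longlonglongrightarrow> h' t"
        using LIMSEQ_subseq_LIMSEQ[OF LIMSEQ_ignore_initial_segment[OF lim[OF t], of N] r]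
        by (simp add: o_def)
      from tendsto_norm[OF tendsto_diff[OF this g[OF t]]] show "norm (h' t - g t) \<le> \<epsilon>"
        by (rule LIMSEQ_le_const2) (use G(2)[OF t] in blast)
    qed
  qed auto
qed

text \<open>
  Approximants of bounded variation exist only from some index on. Before it, the zero function keeps
  the variation bound uniform in \<open>j\<close> without affecting the approximation in the limit. The second
  conclusion passes pointwise boundedness from the given functions to the approximants, as Helly's
  principle requires.
\<close>

lemma eventual_eps_approximants:
  fixes h :: "nat \<Rightarrow> real \<Rightarrow> 'k::real_normed_vector"
  assumes fin: "limsup (\<lambda>j. eps_variation \<epsilon> (h j) T) < \<infinity>" and \<epsilon>: "0 \<le> \<epsilon>"
  obtains G C where "\<And>j. variation (G j) T \<le> ennreal C"
    "\<And>j t. t \<in> T \<Longrightarrow> norm (G j t) \<le> norm (h j t) + \<epsilon>"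
    "\<forall>\<^sub>F j in sequentially. \<forall>t\<in>T. norm (h j t - G j t) \<le> \<epsilon>"
proof -
  obtain c where c: "limsup (\<lambda>j. eps_variation \<epsilon> (h j) T) < c" "c < \<infinity>"
    using dense[OF fin] by blast
  then obtain C where C: "c = ennreal C" by (cases c) auto
  have "\<exists>g. variation g T \<le> c \<and> (\<forall>t\<in>T. norm (g t) \<le> norm (h j t) + \<epsilon>) \<and>
      (eps_variation \<epsilon> (h j) T < c \<longrightarrow> (\<forall>t\<in>T. norm (h j t - g t) \<le> \<epsilon>))" for j
  proof (cases "eps_variation \<epsilon> (h j) T < c")
    case True
    then obtain g where g: "variation g T < c" "\<And>t. t \<in> T \<Longrightarrow> norm (h j t - g t) \<le> \<epsilon>"
      using eps_variation_lessE[OF _ \<epsilon>] by blast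
    have "norm (g t) \<le> norm (h j t) + \<epsilon>" if "t \<in> T" for t
      using g(2)[OF that] norm_triangle_sub[of "g t" "h j t"] by (simp add: norm_minus_commute)
    with g show ?thesis by (auto intro!: exI[of _ g])
  next
    case False
    with \<epsilon> show ?thesis by (intro exI[of _ "\<lambda>_. 0"]) (simp add: variation_const)
  qed
  then obtain G where G: "\<And>j. variation (G j) T \<le> c"
    "\<And>j t. t \<in> T \<Longrightarrow> norm (G j t) \<le> norm (h j t) + \<epsilon>"
    "\<And>j. eps_variation \<epsilon> (h j) T < c \<Longrightarrow> \<forall>t\<in>T. norm (h j t - G j t) \<le> \<epsilon>"
    by metis
  have "\<forall>\<^sub>F j in sequentially. \<forall>t\<in>T. norm (h j t - G j t) \<le> \<epsilon>"
    using Limsup_lessD[OF c(1)] by eventually_elim (rule G(3))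
  with G(1,2) show thesis unfolding C by (rule that)
qed

section \<open>The selection principle\<close>

text \<open>
  Scalar form: finitely bounded \<open>\<epsilon>\<close>-variations let one subsequence converge pointwise for all
  members of a countable family at once.
\<close>

lemma eps_variation_selection_family:
  fixes h :: "nat \<Rightarrow> 'p \<Rightarrow> real \<Rightarrow> 'k::euclidean_space"
  assumes P: "countable P"
    and bdd: "\<And>p t. p \<in> P \<Longrightarrow> t \<in> T \<Longrightarrow> \<exists>B. \<forall>j. norm (h j p t) \<le> B"
    and fin: "\<And>p \<epsilon>. p \<in> P \<Longrightarrow> 0 < \<epsilon> \<Longrightarrow> limsup (\<lambda>j. eps_variation \<epsilon> (h j p) T) < \<infinity>"
  obtains r where "strict_mono (r :: nat \<Rightarrow> nat)"
    "\<And>p t. p \<in> P \<Longrightarrow> t \<in> T \<Longrightarrow> convergent (\<lambda>j. h (r j) p t)"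
proof -
  define \<epsilon> where "\<epsilon> k = inverse (real (Suc k))" for k
  define approximants where "approximants p k G C \<longleftrightarrow> (\<forall>j. variation (G j) T \<le> ennreal C) \<and>
      (\<forall>j. \<forall>t\<in>T. norm (G j t) \<le> norm (h j p t) + \<epsilon> k) \<and>
      (\<forall>\<^sub>F j in sequentially. \<forall>t\<in>T. norm (h j p t - G j t) \<le> \<epsilon> k)" for p k G C
  have "\<exists>G C. approximants p k G C" if p: "p \<in> P" for p k
  proof -
    have k: "0 < \<epsilon> k" by (simp add: \<epsilon>_def)
    show ?thesis unfolding approximants_def
      by (rule eventual_eps_approximants[OF fin[OF p k] less_imp_le[OF k]]) blast
  qed
  then obtain G C where "\<And>p k. p \<in> P \<Longrightarrow> approximants p k (G p k) (C p k)"
    by metis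
  then have G: "\<And>p k j. p \<in> P \<Longrightarrow> variation (G p k j) T \<le> ennreal (C p k)"
    "\<And>p k j t. p \<in> P \<Longrightarrow> t \<in> T \<Longrightarrow> norm (G p k j t) \<le> norm (h j p t) + \<epsilon> k"
    "\<And>p k. p \<in> P \<Longrightarrow> \<forall>\<^sub>F j in sequentially. \<forall>t\<in>T. norm (h j p t - G p k j t) \<le> \<epsilon> k"
    unfolding approximants_def by blast+
  have "\<exists>B. \<forall>j. norm (G (fst z) (snd z) j t) \<le> B"
    if "z \<in> P \<times> (UNIV :: nat set)" and t: "t \<in> T" for z t
  proof -
    from that have z: "fst z \<in> P" by auto
    from bdd[OF z t] obtain B where "\<And>j. norm (h j (fst z) t) \<le> B" by blast
    with G(2)[OF z t] have "norm (G (fst z) (snd z) j t) \<le> B + \<epsilon> (snd z)" for j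
      by (meson add_right_mono order_trans)
    then show ?thesis by blast
  qed
  moreover have "countable (P \<times> (UNIV :: nat set))" using P by simp
  moreover have "variation (G (fst z) (snd z) j) T \<le> ennreal (C (fst z) (snd z))"
    if "z \<in> P \<times> (UNIV :: nat set)" for z j
    using G(1) that by auto
  ultimately obtain r where r: "strict_mono (r :: nat \<Rightarrow> nat)"
    and conv: "\<And>z t. z \<in> P \<times> (UNIV :: nat set) \<Longrightarrow> t \<in> T \<Longrightarrow>
      convergent (\<lambda>j. G (fst z) (snd z) (r j) t)"
    using helly_bounded_variation_family[of "P \<times> (UNIV :: nat set)"
        "\<lambda>j z. G (fst z) (snd z) j" T "\<lambda>z. C (fst z) (snd z)"] by blast
  have "convergent (\<lambda>j. h (r j) p t)" if p: "p \<in> P" and t: "t \<in> T" for p t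
  proof (rule convergent_if_approximable)
    fix e :: real assume "0 < e"
    then obtain k where k: "\<epsilon> k < e" using reals_Archimedean unfolding \<epsilon>_def by blast
    have "\<forall>\<^sub>F j in sequentially. norm (h j p t - G p k j t) \<le> e"
      using G(3)[OF p, of k] by eventually_elim (use t k in force)
    from eventually_subseq[OF r this]
    have "\<forall>\<^sub>F j in sequentially. norm (h (r j) p t - G p k (r j) t) \<le> e" .
    with conv[of "(p, k)" t] p t show "\<exists>b. convergent b \<and>
        (\<forall>\<^sub>F j in sequentially. norm (h (r j) p t - b j) \<le> e)"
      by (intro exI[of _ "\<lambda>j. G p k (r j) t"]) simp
  qed
  with r show thesis by (rule that)
qed

theorem theorem4p16:
  fixes smul :: "'k::{real_normed_field, euclidean_space} \<Rightarrow> 'm::banach \<Rightarrow> 'm"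
    and T :: "real set"
    and f :: "nat \<Rightarrow> real \<Rightarrow> 'm"
    and v :: "('m \<Rightarrow>\<^sub>L 'k) \<Rightarrow> real \<Rightarrow> ennreal"
  assumes "normed_space smul"
    and "reflexive_space smul"
    and "separable_space (top_of_set (dual smul))"
    and "T \<noteq> {}"
    and "\<And>t. t \<in> T \<Longrightarrow> (SUP j. ennreal (norm (f j t))) < \<infinity>"
    and "\<And>\<phi> \<epsilon>. v \<phi> \<epsilon> = limsup (\<lambda>j. eps_variation \<epsilon> (\<lambda>t. blinfun_apply \<phi> (f j t)) T)"
    and "\<And>\<phi> \<epsilon>. \<phi> \<in> dual smul \<Longrightarrow> \<epsilon> > 0 \<Longrightarrow> v \<phi> \<epsilon> < \<infinity>"
  shows "\<exists>(r :: nat \<Rightarrow> nat) (g :: real \<Rightarrow> 'm). strict_mono r \<and>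
    (\<forall>\<epsilon>>0. \<forall>\<phi>\<in>dual smul. eps_variation \<epsilon> (\<lambda>t. blinfun_apply \<phi> (g t)) T \<le> v \<phi> \<epsilon>) \<and>
    (\<forall>t\<in>T. weakly_converges smul (\<lambda>j. f (r j) t) (g t))"
proof -
  note refl = assms(2) and fin = assms(7)[unfolded assms(6)]
  have "\<exists>B. \<forall>j. norm (f j t) \<le> B" if t: "t \<in> T" for t
  proof -
    obtain B where B: "(SUP j. ennreal (norm (f j t))) = ennreal B" "0 \<le> B"
      using assms(5)[OF t] by (cases "SUP j. ennreal (norm (f j t))") auto
    have "ennreal (norm (f j t)) \<le> ennreal B" for j
      unfolding B(1)[symmetric] by (rule SUP_upper) simp
    with B(2) show ?thesis by (auto simp: ennreal_le_iff)
  qed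
  then obtain B where B: "\<And>j t. t \<in> T \<Longrightarrow> norm (f j t) \<le> B t" by metis
  obtain D where D: "countable D" "D \<subseteq> dual smul" "dual smul \<subseteq> closure D"
    using separable_dual_dense[OF assms(3)] by blast
  have bdd: "\<exists>b. \<forall>j. norm (blinfun_apply \<phi> (f j t)) \<le> b" if t: "t \<in> T"
    for \<phi> :: "'m \<Rightarrow>\<^sub>L 'k" and t
    using norm_blinfun[of \<phi>] mult_left_mono[OF B[OF t], of "norm \<phi>"]
    by (meson norm_ge_zero order_trans)
  obtain r where r: "strict_mono (r :: nat \<Rightarrow> nat)"
    and conv: "\<And>\<phi> t. \<phi> \<in> D \<Longrightarrow> t \<in> T \<Longrightarrow> convergent (\<lambda>j. blinfun_apply \<phi> (f (r j) t))"
    using eps_variation_selection_family[of D T "\<lambda>j \<phi> t. blinfun_apply \<phi> (f j t)"]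
      D bdd fin by (metis subsetD)
  have "\<exists>x. weakly_converges smul (\<lambda>j. f (r j) t) x" if t: "t \<in> T" for t
  proof (rule reflexive_weak_limit[OF refl B[OF t]])
    show "convergent (\<lambda>j. blinfun_apply \<phi> (f (r j) t))" if "\<phi> \<in> dual smul" for \<phi>
      using that D(3) by (intro convergent_blinfun_on_closure[OF B[OF t] conv[OF _ t]]) auto
  qed
  then obtain g where g: "\<And>t. t \<in> T \<Longrightarrow> weakly_converges smul (\<lambda>j. f (r j) t) (g t)"
    by metis
  have "eps_variation \<epsilon> (\<lambda>t. blinfun_apply \<phi> (g t)) T \<le> v \<phi> \<epsilon>"
    if \<epsilon>: "0 < \<epsilon>" and \<phi>: "\<phi> \<in> dual smul" for \<epsilon> \<phi>
  proof -
    have "eps_variation \<epsilon> (\<lambda>t. blinfun_apply \<phi> (g t)) T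
        \<le> limsup (\<lambda>j. eps_variation \<epsilon> (\<lambda>t. blinfun_apply \<phi> (f (r j) t)) T)"
      using g \<phi> \<epsilon> by (intro eps_variation_limit_le) (auto simp: weakly_converges_def)
    also have "\<dots> \<le> v \<phi> \<epsilon>"
      using limsup_subseq_mono[OF r, of "\<lambda>j. eps_variation \<epsilon> (\<lambda>t. blinfun_apply \<phi> (f j t)) T"]
      unfolding assms(6) by (simp add: o_def)
    finally show ?thesis .
  qed
  with r g show ?thesis by blast
qed

end
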